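(* Let $S$ be a regular tubular surface of radius $r>0$ in Euclidean $3$-space with Gaussian curvature $K$ and mean curvature $H$, and let $\mathcal{Q}_E(S)$ be the set of all polynomials $Q\in\mathbb{R}[x,y]$ satisfying $Q(K,H)\equiv0$. For $Q\in\mathbb{R}[x,y]$ put $Rad_E(Q)=\{\rho\in(0,+\infty)\,:\,Q(0,\tfrac{1}{2\rho})=0\}$. (i) If $S$ is a right cylinder, then $\mathcal{Q}_E(S)=\{Q\in\mathbb{R}[x,y]\,:\,r\in Rad_E(Q)\}$. (ii) If $S$ is not a right cylinder, then $\mathcal{Q}_E(S)$ is the ideal of $\mathbb{R}[x,y]$ generated by the polynomial $xr^2-2ry+1$.
   Context: Let $\gamma:(a,b)\to\mathbb{E}^3$ be a smooth curve with nonzero tangent vectors (the central curve) and let $r>0$. The tubular surface of radius $r$ around $\gamma$ is the union of all circles of radius $r$ and center $\gamma(s)$ contained in the planes through $\gamma(s)$ normal to $\gamma'(s)$, $s\in(a,b)$; it is parametrized by the pairs $(s,v)$ with $v$ a unit vector orthogonal to $\gamma'(s)$, via $(s,v)\mapsto\gamma(s)+rv$. It is called regular if $\gamma$ is parametrized by arc length and $1-r\kappa(s)\cos t\neq0$ for all $(s,t)\in(a,b)\times\mathbb{R}$, where $\kappa=\|\gamma''\|$; the parametrization is then an immersion, and $K$ and $H$ are the Gaussian and mean curvatures of this immersed surface, where $H$ is half the sum of the principal curvatures, computed with the unit normal $-v$ at the point $(s,v)$ (pointing toward the central curve; so a cylinder of radius $r$ has $K=0$, $H=\frac1{2r}$).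 A right cylinder is a regular tubular surface with $\kappa\equiv0$. *)

theory Defs
  imports
    "HOL-Analysis.Analysis"
    "HOL-Computational_Algebra.Polynomial"
begin

section \<open>Curvatures of an immersed surface\<close>

text \<open>
  The velocities at \<open>p\<close> of curves lying in \<open>M\<close>. If \<open>M\<close> is an embedded submanifold of
  the ambient Euclidean space, this is its tangent space at \<open>p\<close>, regarded as a linear subspace
  of the ambient space.
\<close>

definition tangent_space :: "'a::euclidean_space set \<Rightarrow> 'a \<Rightarrow> 'a set" where
  "tangent_space M p =
     {\<xi>. \<exists>c. c 0 = p \<and> (\<forall>\<^sub>F t in nhds (0::real). c t \<in> M) \<and> (c has_vector_derivative \<xi>) (at 0)}"

text \<open>
  A surface is given by a two-dimensional submanifold \<open>M\<close> of a Euclidean space, a map \<open>f\<close> to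
  3-space that is defined and differentiable near \<open>M\<close> in the ambient space and restricts to an
  immersion of \<open>M\<close>, and a map \<open>N\<close>, differentiable near \<open>M\<close>, that restricts to a unit normal
  field along \<open>f\<close>. The shape operator \<open>A\<close> at \<open>p\<close> is the endomorphism of the tangent space with
  \<open>df \<circ> A = - dN\<close>; its eigenvalues, with multiplicity, are the principal curvatures.
\<close>

definition principal_curvatures ::
  "'a::euclidean_space set \<Rightarrow> ('a \<Rightarrow> real^3) \<Rightarrow> ('a \<Rightarrow> real^3) \<Rightarrow> 'a \<Rightarrow> real \<Rightarrow> real \<Rightarrow> bool" where
  "principal_curvatures M f N p k\<^sub>1 k\<^sub>2 \<longleftrightarrow>
     (\<exists>\<xi>\<^sub>1 \<xi>\<^sub>2. \<xi>\<^sub>1 \<noteq> \<xi>\<^sub>2 \<and> independent {\<xi>\<^sub>1, \<xi>\<^sub>2} \<and> span {\<xi>\<^sub>1, \<xi>\<^sub>2} = tangent_space M p \<and>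
        - frechet_derivative N (at p) \<xi>\<^sub>1 = k\<^sub>1 *\<^sub>R frechet_derivative f (at p) \<xi>\<^sub>1 \<and>
        - frechet_derivative N (at p) \<xi>\<^sub>2 = k\<^sub>2 *\<^sub>R frechet_derivative f (at p) \<xi>\<^sub>2)"

definition gaussian_curvature ::
  "'a::euclidean_space set \<Rightarrow> ('a \<Rightarrow> real^3) \<Rightarrow> ('a \<Rightarrow> real^3) \<Rightarrow> 'a \<Rightarrow> real" where
  "gaussian_curvature M f N p =
     (THE K. \<exists>k\<^sub>1 k\<^sub>2. principal_curvatures M f N p k\<^sub>1 k\<^sub>2 \<and> K = k\<^sub>1 * k\<^sub>2)"

definition mean_curvature ::
  "'a::euclidean_space set \<Rightarrow> ('a \<Rightarrow> real^3) \<Rightarrow> ('a \<Rightarrow> real^3) \<Rightarrow> 'a \<Rightarrow> real" where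
  "mean_curvature M f N p =
     (THE H. \<exists>k\<^sub>1 k\<^sub>2. principal_curvatures M f N p k\<^sub>1 k\<^sub>2 \<and> H = (k\<^sub>1 + k\<^sub>2) / 2)"


section \<open>Tubular surfaces\<close>

text \<open>
  The endpoints of the parameter interval are extended reals, so unbounded open intervals are
  included. The values of the central curve outside the interval play no role. The surface is
  parametrized by the unit normal bundle \<open>tube_domain\<close> of the central curve; no normal frame is
  chosen. The normal \<open>- v\<close> at \<open>(s, v)\<close> points toward the central curve, which makes the mean
  curvature of a cylinder of radius \<open>r\<close> equal to \<open>1 / (2 * r)\<close>.
\<close>

definition curve_deriv :: "(real \<Rightarrow> real^3) \<Rightarrow> real \<Rightarrow> real^3" where
  "curve_deriv \<gamma> s = vector_derivative \<gamma> (at s)"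

definition smooth_curve :: "ereal \<Rightarrow> ereal \<Rightarrow> (real \<Rightarrow> real^3) \<Rightarrow> bool" where
  "smooth_curve a b \<gamma> \<longleftrightarrow>
     (\<forall>n. \<forall>s\<in>einterval a b. (curve_deriv ^^ n) \<gamma> differentiable (at s))"

definition curvature :: "(real \<Rightarrow> real^3) \<Rightarrow> real \<Rightarrow> real" where
  "curvature \<gamma> s = norm (curve_deriv (curve_deriv \<gamma>) s)"

definition regular_tubular_surface :: "ereal \<Rightarrow> ereal \<Rightarrow> (real \<Rightarrow> real^3) \<Rightarrow> real \<Rightarrow> bool" where
  "regular_tubular_surface a b \<gamma> r \<longleftrightarrow>
     a < b \<and> r > 0 \<and> smooth_curve a b \<gamma> \<and>
     (\<forall>s\<in>einterval a b. curve_deriv \<gamma> s \<noteq> 0) \<and>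
     (\<forall>s\<in>einterval a b. norm (curve_deriv \<gamma> s) = 1) \<and>
     (\<forall>s\<in>einterval a b. \<forall>t::real. 1 - r * curvature \<gamma> s * cos t \<noteq> 0)"

definition right_cylinder :: "ereal \<Rightarrow> ereal \<Rightarrow> (real \<Rightarrow> real^3) \<Rightarrow> real \<Rightarrow> bool" where
  "right_cylinder a b \<gamma> r \<longleftrightarrow>
     regular_tubular_surface a b \<gamma> r \<and> (\<forall>s\<in>einterval a b. curvature \<gamma> s = 0)"

definition tube_domain :: "ereal \<Rightarrow> ereal \<Rightarrow> (real \<Rightarrow> real^3) \<Rightarrow> (real \<times> (real^3)) set" where
  "tube_domain a b \<gamma> = {(s, v). s \<in> einterval a b \<and> norm v = 1 \<and> v \<bullet> curve_deriv \<gamma> s = 0}"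

definition tube_map :: "(real \<Rightarrow> real^3) \<Rightarrow> real \<Rightarrow> real \<times> (real^3) \<Rightarrow> real^3" where
  "tube_map \<gamma> r = (\<lambda>(s, v). \<gamma> s + r *\<^sub>R v)"

definition tube_normal :: "real \<times> (real^3) \<Rightarrow> real^3" where
  "tube_normal = (\<lambda>(s, v). - v)"

definition tube_K :: "ereal \<Rightarrow> ereal \<Rightarrow> (real \<Rightarrow> real^3) \<Rightarrow> real \<Rightarrow> real \<times> (real^3) \<Rightarrow> real" where
  "tube_K a b \<gamma> r = gaussian_curvature (tube_domain a b \<gamma>) (tube_map \<gamma> r) tube_normal"

definition tube_H :: "ereal \<Rightarrow> ereal \<Rightarrow> (real \<Rightarrow> real^3) \<Rightarrow> real \<Rightarrow> real \<times> (real^3) \<Rightarrow> real" where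
  "tube_H a b \<gamma> r = mean_curvature (tube_domain a b \<gamma>) (tube_map \<gamma> r) tube_normal"


section \<open>Polynomials in two variables\<close>

text \<open>
  The ring \<open>\<real>[x,y]\<close> is represented as \<open>\<real>[x][y]\<close>: the inner variable is \<open>x\<close>, the outer one
  is \<open>y\<close>.
\<close>

definition poly_x :: "real poly poly" where
  "poly_x = [:[:0, 1:]:]"

definition poly_y :: "real poly poly" where
  "poly_y = [:0, 1:]"

definition poly_const :: "real \<Rightarrow> real poly poly" where
  "poly_const c = [:[:c:]:]"

definition eval_xy :: "real poly poly \<Rightarrow> real \<Rightarrow> real \<Rightarrow> real" where
  "eval_xy Q x y = poly (poly Q [:y:]) x"

lemma eval_xy_simps:
  "eval_xy poly_x x y = x"
  "eval_xy poly_y x y = y"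
  "eval_xy (poly_const c) x y = c"
  "eval_xy 1 x y = 1"
  "eval_xy (P + Q) x y = eval_xy P x y + eval_xy Q x y"
  "eval_xy (P - Q) x y = eval_xy P x y - eval_xy Q x y"
  "eval_xy (P * Q) x y = eval_xy P x y * eval_xy Q x y"
  by (simp_all add: eval_xy_def poly_x_def poly_y_def poly_const_def)

text \<open>Ideals are the submodules of a commutative ring over itself.\<close>

lemma module_times: "module ((*) :: 'a::comm_ring_1 \<Rightarrow> 'a \<Rightarrow> 'a)"
  by standard (simp_all add: algebra_simps)

definition ideal_generated :: "'a::comm_ring_1 set \<Rightarrow> 'a set" where
  "ideal_generated B = module.span (*) B"

definition Q_E :: "ereal \<Rightarrow> ereal \<Rightarrow> (real \<Rightarrow> real^3) \<Rightarrow> real \<Rightarrow> real poly poly set" where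
  "Q_E a b \<gamma> r =
     {Q. \<forall>p\<in>tube_domain a b \<gamma>. eval_xy Q (tube_K a b \<gamma> r p) (tube_H a b \<gamma> r p) = 0}"

definition Rad_E :: "real poly poly \<Rightarrow> real set" where
  "Rad_E Q = {\<rho>. \<rho> > 0 \<and> eval_xy Q 0 (1 / (2 * \<rho>)) = 0}"

end

theory Submission
  imports Defs
begin

text \<open>
  Put \<open>T = \<gamma>'\<close> and \<open>c = v \<bullet> \<gamma>''\<close>. Differentiating \<open>v \<bullet> v = 1\<close> and \<open>v \<bullet> T = 0\<close> shows that
  \<open>(1, - c T)\<close> and \<open>(0, v \<times> T)\<close> span the tangent plane of the unit normal bundle at \<open>(s, v)\<close>. Both are
  principal directions, with the distinct principal curvatures \<open>- c / (1 - r c)\<close> and \<open>1 / r\<close>; hence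
  \<open>H = (r\<^sup>2 K + 1) / (2 r)\<close>. If \<open>\<kappa> \<noteq> 0\<close> somewhere, then \<open>c\<close> takes all values in \<open>[- \<kappa>, \<kappa>]\<close> there, so
  \<open>K\<close> takes infinitely many values, and \<open>Q(K, H) = 0\<close> forces \<open>Q(x, (r\<^sup>2 x + 1) / (2 r)) = 0\<close> as a
  polynomial in \<open>x\<close>. The factor theorem over \<open>\<real>[x]\<close> then shows that \<open>Q\<close> is a multiple of the generator.
\<close>

section \<open>Orthonormal frames in 3-space\<close>

lemma cross3_of_orthonormal:
  assumes "norm u = 1" "norm v = 1" "u \<bullet> v = 0"
  shows "cross3 u v \<bullet> cross3 u v = 1" "cross3 u v \<bullet> u = 0" "cross3 u v \<bullet> v = 0"
  using norm_cross_dot [of u v] assms dot_cross_self [of u v] dot_cross_self [of v u]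
  by (simp_all add: power2_norm_eq_inner)

text \<open>Lagrange's formula gives x \<times> (v \<times> T) = (x \<bullet> T) v - (x \<bullet> v)
  T = 0. A second use, on B \<times> (x \<times> B) with B = v \<times> T, turns this into (B
  \<bullet> B) x = (B \<bullet> x) B.\<close>

lemma orthogonal_to_pair_in_span_cross3:
  fixes T v x :: "real^3"
  assumes "norm T = 1" "norm v = 1" "v \<bullet> T = 0" "x \<bullet> T = 0" "x \<bullet> v = 0"
  shows "x = (cross3 v T \<bullet> x) *\<^sub>R cross3 v T"
proof -
  let ?B = "cross3 v T"
  have "cross3 x ?B = 0"
    using assms by (simp add: Lagrange)
  moreover have "cross3 ?B (cross3 x ?B) = (?B \<bullet> ?B) *\<^sub>R x - (?B \<bullet> x) *\<^sub>R ?B"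
    by (rule Lagrange)
  moreover have "?B \<bullet> ?B = 1"
    using assms by (simp add: cross3_of_orthonormal)
  ultimately show ?thesis by simp
qed

section \<open>Tangent vectors of the unit normal bundle\<close>

lemma curve_deriv_has_vector_derivative:
  assumes "smooth_curve a b \<gamma>" "s \<in> einterval a b"
  shows "(\<gamma> has_vector_derivative curve_deriv \<gamma> s) (at s)"
    and "(curve_deriv \<gamma> has_vector_derivative curve_deriv (curve_deriv \<gamma>) s) (at s)"
  using assms(1)[unfolded smooth_curve_def, rule_format, of s 0]
    assms(1)[unfolded smooth_curve_def, rule_format, of s 1] assms(2)
  by (simp_all add: curve_deriv_def vector_derivative_works)

lemma eventually_einterval:
  assumes "s \<in> einterval a b" "(h \<longlongrightarrow> s) F"
  shows "\<forall>\<^sub>F t in F. h t \<in> einterval a b"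
  using topological_tendstoD [OF assms(2) open_einterval assms(1)] .

lemma inner_vector_derivative_eq_0:
  fixes f g :: "real \<Rightarrow> 'a::real_inner"
  assumes "(f has_vector_derivative f') (at x)" "(g has_vector_derivative g') (at x)"
    and "\<forall>\<^sub>F t in nhds x. f t \<bullet> g t = C"
  shows "f x \<bullet> g' + f' \<bullet> g x = 0"
proof -
  have "((\<lambda>t. f t \<bullet> g t) has_vector_derivative (f x \<bullet> g' + f' \<bullet> g x)) (at x)"
    using bounded_bilinear.has_vector_derivative [OF bounded_bilinear_inner assms(1,2)] .
  moreover have "((\<lambda>t. f t \<bullet> g t) has_vector_derivative 0) (at x)"
  proof (rule has_vector_derivative_transform_within_open [where f = "\<lambda>_. C"])
    \<comment> \<open>The points near which the inner product is constantly \<open>C\<close> form an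
      open set containing \<open>x\<close>; on it the function may be exchanged for the
      constant.\<close>
    show "open {t. \<forall>\<^sub>F u in nhds t. f u \<bullet> g u = C}"
      by (metis (no_types, lifting) eventually_eventually eventually_nhds open_subopen mem_Collect_eq subsetI)
  qed (use assms(3) in \<open>auto dest: eventually_nhds_x_imp_x\<close>)
  ultimately show ?thesis
    by (rule vector_derivative_unique_at)
qed

text \<open>Differentiate T \<bullet> T = 1. Thus \<gamma>'' lies in the normal plane, which is why
  unit normals v can make v \<bullet> \<gamma>'' as large as \<kappa>.\<close>

lemma tangent_orthogonal_acceleration:
  assumes "regular_tubular_surface a b \<gamma> r" "s \<in> einterval a b"
  shows "curve_deriv \<gamma> s \<bullet> curve_deriv (curve_deriv \<gamma>) s = 0"
proof -
  have sm: "smooth_curve a b \<gamma>" and n: "\<And>s. s \<in> einterval a b \<Longrightarrow> norm (curve_deriv \<gamma> s) = 1"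
    using assms(1) by (auto simp: regular_tubular_surface_def)
  note d = curve_deriv_has_vector_derivative(2) [OF sm assms(2)]
  have "\<forall>\<^sub>F t in nhds s. t \<in> einterval a b"
    by (rule eventually_einterval [OF assms(2)]) (simp add: filterlim_ident)
  then have "\<forall>\<^sub>F t in nhds s. curve_deriv \<gamma> t \<bullet> curve_deriv \<gamma> t = 1"
    by eventually_elim (simp add: n norm_eq_1 [symmetric])
  from inner_vector_derivative_eq_0 [OF d d this] show ?thesis
    by (simp add: inner_commute)
qed

text \<open>Differentiating the two constraints along a curve in the bundle gives one inclusion. As
  tangent vectors are defined as velocities, the converse requires an explicit curve for each
  solution of the linear equations.\<close>

lemma tangent_space_tube_domain:
  assumes reg: "regular_tubular_surface a b \<gamma> r" and p: "(s, v) \<in> tube_domain a b \<gamma>"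
  shows "tangent_space (tube_domain a b \<gamma>) (s, v) =
    {(\<sigma>, w). w \<bullet> v = 0 \<and>
       w \<bullet> curve_deriv \<gamma> s + \<sigma> * (v \<bullet> curve_deriv (curve_deriv \<gamma>) s) = 0}"
    (is "?L = ?R")
proof -
  let ?T = "curve_deriv \<gamma>"
  let ?k = "curve_deriv ?T s"
  have sm: "smooth_curve a b \<gamma>" and n: "\<And>s. s \<in> einterval a b \<Longrightarrow> norm (?T s) = 1"
    using reg by (auto simp: regular_tubular_surface_def)
  have s: "s \<in> einterval a b" and v: "norm v = 1" "v \<bullet> ?T s = 0"
    using p by (auto simp: tube_domain_def)
  note d = curve_deriv_has_vector_derivative(2) [OF sm s]
  have "\<xi> \<in> ?R" if L: "\<xi> \<in> ?L" for \<xi>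
  proof -
    obtain \<sigma> w where \<xi>: "\<xi> = (\<sigma>, w)" by (cases \<xi>)
    obtain c where c: "c 0 = (s, v)" "\<forall>\<^sub>F t in nhds (0::real). c t \<in> tube_domain a b \<gamma>"
      "(c has_vector_derivative (\<sigma>, w)) (at 0)"
      using L \<xi> by (auto simp: tangent_space_def)
    have d1: "((\<lambda>t. fst (c t)) has_vector_derivative \<sigma>) (at 0)"
      using bounded_linear.has_vector_derivative [OF bounded_linear_fst c(3)] by simp
    have d2: "((\<lambda>t. snd (c t)) has_vector_derivative w) (at 0)"
      using bounded_linear.has_vector_derivative [OF bounded_linear_snd c(3)] by simp
    have d3: "((?T \<circ> (\<lambda>t. fst (c t))) has_vector_derivative \<sigma> *\<^sub>R ?k) (at 0)"
      by (rule vector_diff_chain_at [OF d1]) (use c d in simp)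
    have e1: "\<forall>\<^sub>F t in nhds 0. snd (c t) \<bullet> snd (c t) = 1"
      using c(2) by eventually_elim (auto simp: tube_domain_def norm_eq_1)
    have e2: "\<forall>\<^sub>F t in nhds 0. snd (c t) \<bullet> (?T \<circ> (\<lambda>t. fst (c t))) t = 0"
      using c(2) by eventually_elim (auto simp: tube_domain_def)
    have "w \<bullet> v = 0"
      using inner_vector_derivative_eq_0 [OF d2 d2 e1] c(1) by (simp add: inner_commute)
    moreover have "w \<bullet> ?T s + \<sigma> * (v \<bullet> ?k) = 0"
      using inner_vector_derivative_eq_0 [OF d2 d3 e2] c(1) by (simp add: algebra_simps)
    ultimately show ?thesis using \<xi> by simp
  qed
  moreover have "(\<sigma>, w) \<in> ?L" if "w \<bullet> v = 0" "w \<bullet> ?T s + \<sigma> * (v \<bullet> ?k) = 0" for \<sigma> w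
  proof -
    \<comment> \<open>Move linearly in direction \<open>(\<sigma>, w)\<close>, project onto the normal plane of the curve, and normalize.\<close>
    define h where "h t = s + t * \<sigma>" for t :: real
    define x where "x t = (v + t *\<^sub>R w) - ((v + t *\<^sub>R w) \<bullet> ?T (h t)) *\<^sub>R ?T (h t)" for t
    define y where "y t = (1 / sqrt (x t \<bullet> x t)) *\<^sub>R x t" for t
    have h0: "h 0 = s" and x0: "x 0 = v" and y0: "y 0 = v"
      using v by (simp_all add: h_def x_def y_def norm_eq_1)
    have dh: "(h has_vector_derivative \<sigma>) (at 0)"
      unfolding h_def by (auto intro!: derivative_eq_intros)
    have "((?T \<circ> h) has_vector_derivative \<sigma> *\<^sub>R ?k) (at 0)"
      by (rule vector_diff_chain_at [OF dh]) (use h0 d in simp)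
    then have dT: "((\<lambda>t. ?T (h t)) has_derivative (\<lambda>t. t *\<^sub>R \<sigma> *\<^sub>R ?k)) (at 0)"
      by (simp add: has_vector_derivative_def o_def)
    \<comment> \<open>The term with the derivative of the outer factor T has coefficient v \<bullet>
      T = 0, and the remaining coefficient of T vanishes by the second tangency equation. So the
      projection leaves the velocity w unchanged.\<close>
    have dx: "(x has_derivative (\<lambda>t. t *\<^sub>R w)) (at 0)"
    proof -
      have "(x has_derivative
          (\<lambda>t. t *\<^sub>R w - (t * (w \<bullet> ?T s + \<sigma> * (v \<bullet> ?k))) *\<^sub>R ?T s)) (at 0)"
        unfolding x_def using v h0
        by (auto intro!: derivative_eq_intros dT simp: algebra_simps)
      then show ?thesis by (simp add: that(2))
    qed
    \<comment> \<open>Since w \<bullet> v = 0, the length of \<open>x\<close> is stationary at 0 and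
      normalizing does not alter the velocity either.\<close>
    have dy: "(y has_vector_derivative w) (at 0)"
      unfolding y_def has_vector_derivative_def
      using v x0 that(1)
      by (auto intro!: derivative_eq_intros dx simp: norm_eq_1 inner_commute)
    have "(h \<longlongrightarrow> h 0) (at 0)" "(x \<longlongrightarrow> x 0) (at 0)"
      using has_vector_derivative_continuous [OF dh] has_derivative_continuous [OF dx]
      by (simp_all add: continuous_at)
    then have lim: "(h \<longlongrightarrow> s) (nhds 0)" "(x \<longlongrightarrow> v) (nhds 0)"
      using tendsto_at_iff_tendsto_nhds [of h 0] tendsto_at_iff_tendsto_nhds [of x 0]
      by (simp_all add: h0 x0)
    have "\<forall>\<^sub>F t in nhds 0. x t \<noteq> 0"
      by (rule tendsto_imp_eventually_ne [OF lim(2)]) (use v in auto)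
    with eventually_einterval [OF s lim(1)]
    have "\<forall>\<^sub>F t in nhds 0. (h t, y t) \<in> tube_domain a b \<gamma>"
    proof eventually_elim
      case (elim t)
      have "x t \<bullet> ?T (h t) = 0"
        using n [OF elim(1)] by (simp add: x_def algebra_simps norm_eq_1)
      then show ?case
        using elim by (simp add: tube_domain_def y_def norm_eq_sqrt_inner [symmetric])
    qed
    moreover have "((\<lambda>t. (h t, y t)) has_vector_derivative (\<sigma>, w)) (at 0)"
      by (rule has_vector_derivative_Pair [OF dh dy])
    ultimately show ?thesis
      unfolding tangent_space_def using h0 y0
      by (auto intro!: exI [of _ "\<lambda>t. (h t, y t)"])
  qed
  ultimately show ?thesis by auto
qed

section \<open>Principal curvatures of the tube\<close>

lemma frechet_derivative_tube_map:
  assumes "(\<gamma> has_vector_derivative \<gamma>') (at s)"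
  shows "frechet_derivative (tube_map \<gamma> r) (at (s, v)) = (\<lambda>(\<sigma>, w). \<sigma> *\<^sub>R \<gamma>' + r *\<^sub>R w)"
proof -
  have "(\<gamma> \<circ> fst has_derivative (\<lambda>t. t *\<^sub>R \<gamma>') \<circ> fst) (at (s, v))"
    by (rule diff_chain_at) (use assms in \<open>auto simp: has_vector_derivative_def intro!: derivative_eq_intros\<close>)
  then have "((\<lambda>x. \<gamma> (fst x) + r *\<^sub>R snd x) has_derivative (\<lambda>(\<sigma>, w). \<sigma> *\<^sub>R \<gamma>' + r *\<^sub>R w)) (at (s, v))"
    by (auto simp: o_def case_prod_unfold intro!: derivative_eq_intros)
  then have "(tube_map \<gamma> r has_derivative (\<lambda>(\<sigma>, w). \<sigma> *\<^sub>R \<gamma>' + r *\<^sub>R w)) (at (s, v))"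
    by (simp add: tube_map_def case_prod_unfold)
  then show ?thesis
    by (rule frechet_derivative_at [symmetric])
qed

lemma frechet_derivative_tube_normal:
  "frechet_derivative tube_normal (at p) = (\<lambda>(\<sigma>, w). - w)"
proof -
  have "(tube_normal has_derivative (\<lambda>(\<sigma>, w). - w)) (at p)"
    unfolding tube_normal_def case_prod_unfold by (auto intro!: derivative_eq_intros)
  then show ?thesis
    by (rule frechet_derivative_at [symmetric])
qed

text \<open>Regularity is stated for angles. By Cauchy-Schwarz v \<bullet> \<gamma>'' = \<kappa> cos
  t for some t, so it applies to every unit normal v.\<close>

lemma one_minus_normal_acceleration_nonzero:
  assumes reg: "regular_tubular_surface a b \<gamma> r" and p: "(s, v) \<in> tube_domain a b \<gamma>"
  shows "1 - r * (v \<bullet> curve_deriv (curve_deriv \<gamma>) s) \<noteq> 0"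
proof -
  let ?k = "curve_deriv (curve_deriv \<gamma>) s"
  have s: "s \<in> einterval a b" and v: "norm v = 1"
    using p by (auto simp: tube_domain_def)
  have "\<bar>v \<bullet> ?k\<bar> \<le> norm ?k"
    using Cauchy_Schwarz_ineq2 [of v ?k] v by simp
  then have "\<bar>(v \<bullet> ?k) / norm ?k\<bar> \<le> 1"
    by (simp add: divide_le_eq_1)
  then have "norm ?k * cos (arccos ((v \<bullet> ?k) / norm ?k)) = v \<bullet> ?k"
    by (cases "?k = 0") (simp_all add: cos_arccos_abs)
  then show ?thesis
    using reg s unfolding regular_tubular_surface_def curvature_def
    by (metis mult.assoc)
qed

text \<open>The pair is unordered because the eigenbasis may be listed in either order. Both
  directions of the equivalence matter: the \<open>THE\<close> in the definitions of the curvatures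
  asks for existence and uniqueness.\<close>

lemma principal_curvatures_tube:
  assumes reg: "regular_tubular_surface a b \<gamma> r" and p: "(s, v) \<in> tube_domain a b \<gamma>"
  defines "c \<equiv> v \<bullet> curve_deriv (curve_deriv \<gamma>) s"
  shows "principal_curvatures (tube_domain a b \<gamma>) (tube_map \<gamma> r) tube_normal (s, v) k\<^sub>1 k\<^sub>2
    \<longleftrightarrow> {k\<^sub>1, k\<^sub>2} = {- c / (1 - r * c), 1 / r}"
proof -
  let ?T = "curve_deriv \<gamma> s"
  have sm: "smooth_curve a b \<gamma>" and r: "r > 0" and "norm ?T = 1"
    using reg p by (auto simp: regular_tubular_surface_def tube_domain_def)
  have s: "s \<in> einterval a b" and v: "norm v = 1" "v \<bullet> ?T = 0"
    using p by (auto simp: tube_domain_def)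
  have T: "?T \<bullet> ?T = 1" using \<open>norm ?T = 1\<close> by (simp add: norm_eq_1)
  have rc: "1 - r * c \<noteq> 0"
    using one_minus_normal_acceleration_nonzero [OF reg p] by (simp add: c_def)
  define B where "B = cross3 v ?T"
  have B: "B \<bullet> B = 1" "B \<bullet> ?T = 0" "B \<bullet> v = 0"
    using v \<open>norm ?T = 1\<close> by (simp_all add: B_def cross3_of_orthonormal)
  \<comment> \<open>\<open>\<sigma>\<close> and \<open>\<beta>\<close> are the coordinates with
    respect to the principal directions (1, - c T) and (0, B).\<close>
  define e where "e \<sigma> \<beta> = (\<sigma>, - (\<sigma> * c) *\<^sub>R ?T + \<beta> *\<^sub>R B)" for \<sigma> \<beta> :: real
  have tan: "tangent_space (tube_domain a b \<gamma>) (s, v) = {e \<sigma> \<beta> |\<sigma> \<beta>. True}"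
    unfolding tangent_space_tube_domain [OF reg p] c_def [symmetric]
  proof (intro equalityI subsetI)
    fix x assume "x \<in> {(\<sigma>, w). w \<bullet> v = 0 \<and> w \<bullet> ?T + \<sigma> * c = 0}"
    then obtain \<sigma> w where x: "x = (\<sigma>, w)" "w \<bullet> v = 0" "w \<bullet> ?T + \<sigma> * c = 0" by auto
    have "w + (\<sigma> * c) *\<^sub>R ?T = (B \<bullet> (w + (\<sigma> * c) *\<^sub>R ?T)) *\<^sub>R B"
      unfolding B_def
      by (rule orthogonal_to_pair_in_span_cross3)
        (use v x T \<open>norm ?T = 1\<close> in \<open>auto simp: inner_add_left inner_commute [of ?T v]\<close>)
    then have "w = (B \<bullet> (w + (\<sigma> * c) *\<^sub>R ?T)) *\<^sub>R B - (\<sigma> * c) *\<^sub>R ?T"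
      by (simp only: eq_diff_eq)
    then have "x = e \<sigma> (B \<bullet> (w + (\<sigma> * c) *\<^sub>R ?T))"
      unfolding e_def x(1) by simp
    then show "x \<in> {e \<sigma> \<beta> |\<sigma> \<beta>. True}" by blast
  qed (use B v T in \<open>auto simp: e_def inner_diff_left inner_add_left inner_commute [of ?T v]\<close>)
  have e_lin: "u *\<^sub>R e \<sigma> \<beta> = e (u * \<sigma>) (u * \<beta>)" "e \<sigma> \<beta> + e \<sigma>' \<beta>' = e (\<sigma> + \<sigma>') (\<beta> + \<beta>')"
    for u \<sigma> \<beta> \<sigma>' \<beta>'
    by (simp_all add: e_def algebra_simps)
  have coord: "x *\<^sub>R ?T + y *\<^sub>R B = x' *\<^sub>R ?T + y' *\<^sub>R B \<longleftrightarrow> x = x' \<and> y = y'" for x y x' y'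
  proof
    assume eq: "x *\<^sub>R ?T + y *\<^sub>R B = x' *\<^sub>R ?T + y' *\<^sub>R B"
    have "(x *\<^sub>R ?T + y *\<^sub>R B) \<bullet> ?T = x" "(x *\<^sub>R ?T + y *\<^sub>R B) \<bullet> B = y"
      "(x' *\<^sub>R ?T + y' *\<^sub>R B) \<bullet> ?T = x'" "(x' *\<^sub>R ?T + y' *\<^sub>R B) \<bullet> B = y'"
      using B T by (simp_all add: inner_add_left inner_commute [of ?T B])
    then show "x = x' \<and> y = y'" using eq by simp
  qed auto
  have e_eq: "e \<sigma> \<beta> = e \<sigma>' \<beta>' \<longleftrightarrow> \<sigma> = \<sigma>' \<and> \<beta> = \<beta>'" for \<sigma> \<beta> \<sigma>' \<beta>'
    using coord [of "- (\<sigma> * c)" \<beta> "- (\<sigma>' * c)" \<beta>'] by (auto simp: e_def)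
  \<comment> \<open>In the frame T, B the differential of the tube map has components (1 - r c)
    \<sigma> and r \<beta>, and the negated differential of the normal has - c \<sigma> and \<beta>.
    The eigenvalue equation therefore splits into one equation per coordinate.\<close>
  have eigen: "- frechet_derivative tube_normal (at (s, v)) (e \<sigma> \<beta>) =
      k *\<^sub>R frechet_derivative (tube_map \<gamma> r) (at (s, v)) (e \<sigma> \<beta>)
    \<longleftrightarrow> (\<sigma> = 0 \<or> k = - c / (1 - r * c)) \<and> (\<beta> = 0 \<or> k = 1 / r)" for \<sigma> \<beta> k
  proof -
    have "k *\<^sub>R frechet_derivative (tube_map \<gamma> r) (at (s, v)) (e \<sigma> \<beta>)
      = (k * \<sigma> * (1 - r * c)) *\<^sub>R ?T + (k * r * \<beta>) *\<^sub>R B"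
      unfolding frechet_derivative_tube_map [OF curve_deriv_has_vector_derivative(1) [OF sm s]] e_def
      by (simp add: algebra_simps)
    moreover have "- frechet_derivative tube_normal (at (s, v)) (e \<sigma> \<beta>) = (- (\<sigma> * c)) *\<^sub>R ?T + \<beta> *\<^sub>R B"
      by (simp add: frechet_derivative_tube_normal e_def)
    moreover have "- (\<sigma> * c) = k * \<sigma> * (1 - r * c) \<longleftrightarrow> \<sigma> = 0 \<or> k = - c / (1 - r * c)"
    proof -
      have "- (\<sigma> * c) = k * \<sigma> * (1 - r * c) \<longleftrightarrow> \<sigma> * (k * (1 - r * c) + c) = 0"
        by (auto simp: algebra_simps)
      moreover have "k * (1 - r * c) + c = 0 \<longleftrightarrow> k = - c / (1 - r * c)"
        using rc by (simp only: eq_divide_eq eq_neg_iff_add_eq_0 not_False_eq_True if_True)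
      ultimately show ?thesis by (simp only: mult_eq_0_iff)
    qed
    moreover have "\<beta> = k * r * \<beta> \<longleftrightarrow> \<beta> = 0 \<or> k = 1 / r"
      using r by (auto simp: field_simps)
    ultimately show ?thesis by (simp only: coord)
  qed
  \<comment> \<open>Equality would give - r c = 1 - r c. Distinctness prevents an eigenvector from
    having both coordinates nonzero.\<close>
  have ne: "- c / (1 - r * c) \<noteq> 1 / r"
    using r rc by (auto simp: field_simps)
  have ne0: "e \<sigma> \<beta> = 0 \<longleftrightarrow> \<sigma> = 0 \<and> \<beta> = 0" for \<sigma> \<beta>
    using e_eq [of \<sigma> \<beta> 0 0] by (simp add: e_def zero_prod_def)
  have basis: "e 1 0 \<noteq> e 0 1" "independent {e 1 0, e 0 1}"
    "span {e 1 0, e 0 1} = tangent_space (tube_domain a b \<gamma>) (s, v)"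
  proof -
    show "e 1 0 \<noteq> e 0 1" by (simp add: e_eq)
    show "independent {e 1 0, e 0 1}"
      by (simp add: independent_insert span_singleton e_lin e_eq ne0 image_iff)
    show "span {e 1 0, e 0 1} = tangent_space (tube_domain a b \<gamma>) (s, v)"
      unfolding tan
    proof (intro equalityI subsetI)
      fix x assume "x \<in> span {e 1 0, e 0 1}"
      then obtain k l where "x - k *\<^sub>R e 1 0 = l *\<^sub>R e 0 1"
        by (auto simp: span_insert span_singleton)
      then have "x = e k l"
        by (simp add: diff_eq_eq e_lin)
      then show "x \<in> {e \<sigma> \<beta> |\<sigma> \<beta>. True}" by blast
    next
      fix x assume "x \<in> {e \<sigma> \<beta> |\<sigma> \<beta>. True}"
      then obtain \<sigma> \<beta> where "x = \<sigma> *\<^sub>R e 1 0 + \<beta> *\<^sub>R e 0 1" by (auto simp: e_lin)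
      then show "x \<in> span {e 1 0, e 0 1}"
        by (simp add: span_add span_mul span_base)
    qed
  qed
  show ?thesis
  proof
    assume "principal_curvatures (tube_domain a b \<gamma>) (tube_map \<gamma> r) tube_normal (s, v) k\<^sub>1 k\<^sub>2"
    then obtain \<xi>\<^sub>1 \<xi>\<^sub>2 where \<xi>: "\<xi>\<^sub>1 \<noteq> \<xi>\<^sub>2" "independent {\<xi>\<^sub>1, \<xi>\<^sub>2}"
      "span {\<xi>\<^sub>1, \<xi>\<^sub>2} = tangent_space (tube_domain a b \<gamma>) (s, v)"
      "- frechet_derivative tube_normal (at (s, v)) \<xi>\<^sub>1 =
         k\<^sub>1 *\<^sub>R frechet_derivative (tube_map \<gamma> r) (at (s, v)) \<xi>\<^sub>1"
      "- frechet_derivative tube_normal (at (s, v)) \<xi>\<^sub>2 =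
         k\<^sub>2 *\<^sub>R frechet_derivative (tube_map \<gamma> r) (at (s, v)) \<xi>\<^sub>2"
      unfolding principal_curvatures_def by auto
    have "\<xi>\<^sub>1 \<in> {e \<sigma> \<beta> |\<sigma> \<beta>. True}" "\<xi>\<^sub>2 \<in> {e \<sigma> \<beta> |\<sigma> \<beta>. True}"
      unfolding tan [symmetric] \<xi>(3) [symmetric] by (simp_all add: span_base)
    then obtain \<sigma>\<^sub>1 \<beta>\<^sub>1 \<sigma>\<^sub>2 \<beta>\<^sub>2 where e: "\<xi>\<^sub>1 = e \<sigma>\<^sub>1 \<beta>\<^sub>1" "\<xi>\<^sub>2 = e \<sigma>\<^sub>2 \<beta>\<^sub>2" by auto
    have nz: "\<xi>\<^sub>1 \<noteq> 0" "\<xi>\<^sub>2 \<noteq> 0"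
      using \<xi>(2) dependent_zero by auto
    have not_multiple: "\<xi>\<^sub>1 \<noteq> u *\<^sub>R \<xi>\<^sub>2" for u
      using \<xi>(1,2) by (auto simp: independent_insert span_singleton)
    \<comment> \<open>If both first coordinates vanished, the vectors would be proportional with the
      quotient of the second coordinates as factor, and symmetrically. So each coordinate is nonzero
      in one of the two vectors, and each of the two values occurs.\<close>
    have "\<not> (\<sigma>\<^sub>1 = 0 \<and> \<sigma>\<^sub>2 = 0)" "\<not> (\<beta>\<^sub>1 = 0 \<and> \<beta>\<^sub>2 = 0)"
      using not_multiple [of "\<beta>\<^sub>1 / \<beta>\<^sub>2"] not_multiple [of "\<sigma>\<^sub>1 / \<sigma>\<^sub>2"] nz by (auto simp: e e_lin e_eq ne0)
    then show "{k\<^sub>1, k\<^sub>2} = {- c / (1 - r * c), 1 / r}"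
      using \<xi>(4,5) nz ne by (auto simp: e eigen ne0)
  next
    assume "{k\<^sub>1, k\<^sub>2} = {- c / (1 - r * c), 1 / r}"
    then consider "k\<^sub>1 = - c / (1 - r * c)" "k\<^sub>2 = 1 / r" | "k\<^sub>2 = - c / (1 - r * c)" "k\<^sub>1 = 1 / r"
      by (auto simp: doubleton_eq_iff)
    then show "principal_curvatures (tube_domain a b \<gamma>) (tube_map \<gamma> r) tube_normal (s, v) k\<^sub>1 k\<^sub>2"
    proof cases
      case 1
      show ?thesis unfolding principal_curvatures_def
        by (intro exI [of _ "e 1 0"] exI [of _ "e 0 1"] conjI basis) (simp_all only: eigen 1, simp_all)
    next
      case 2
      show ?thesis unfolding principal_curvatures_def
        by (intro exI [of _ "e 0 1"] exI [of _ "e 1 0"] conjI basis(1) [symmetric]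
            basis(2,3) [unfolded insert_commute [of "e 1 0" "e 0 1"]])
          (simp_all only: eigen 2, simp_all)
    qed
  qed
qed

section \<open>Gaussian and mean curvature, and the values they take\<close>

lemma tube_K_eq:
  assumes "regular_tubular_surface a b \<gamma> r" "(s, v) \<in> tube_domain a b \<gamma>"
  defines "c \<equiv> v \<bullet> curve_deriv (curve_deriv \<gamma>) s"
  shows "tube_K a b \<gamma> r (s, v) = - c / (r * (1 - r * c))"
  unfolding tube_K_def gaussian_curvature_def principal_curvatures_tube [OF assms(1,2)] c_def [symmetric]
proof (rule the_equality)
  show "\<exists>k\<^sub>1 k\<^sub>2. {k\<^sub>1, k\<^sub>2} = {- c / (1 - r * c), 1 / r} \<and> - c / (r * (1 - r * c)) = k\<^sub>1 * k\<^sub>2"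
    by (intro exI [of _ "- c / (1 - r * c)"] exI [of _ "1 / r"]) simp
qed (auto simp: doubleton_eq_iff)

text \<open>One principal curvature is 1 / r, so the other is r K and H = (r K + 1 / r) / 2.\<close>

lemma tube_H_eq:
  assumes "regular_tubular_surface a b \<gamma> r" "(s, v) \<in> tube_domain a b \<gamma>"
  shows "tube_H a b \<gamma> r (s, v) = (r\<^sup>2 * tube_K a b \<gamma> r (s, v) + 1) / (2 * r)"
proof -
  define c where "c = v \<bullet> curve_deriv (curve_deriv \<gamma>) s"
  have "tube_H a b \<gamma> r (s, v) = (- c / (1 - r * c) + 1 / r) / 2"
    unfolding tube_H_def mean_curvature_def principal_curvatures_tube [OF assms] c_def [symmetric]
  proof (rule the_equality)
    show "\<exists>k\<^sub>1 k\<^sub>2. {k\<^sub>1, k\<^sub>2} = {- c / (1 - r * c), 1 / r} \<and>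
        (- c / (1 - r * c) + 1 / r) / 2 = (k\<^sub>1 + k\<^sub>2) / 2"
      by (intro exI [of _ "- c / (1 - r * c)"] exI [of _ "1 / r"]) simp
  qed (auto simp: doubleton_eq_iff)
  also have "\<dots> = (r\<^sup>2 * tube_K a b \<gamma> r (s, v) + 1) / (2 * r)"
  proof -
    have "r > 0" "1 - r * c \<noteq> 0"
      using assms(1) one_minus_normal_acceleration_nonzero [OF assms]
      by (simp_all add: regular_tubular_surface_def c_def)
    then show ?thesis
      unfolding tube_K_eq [OF assms] c_def [symmetric]
      by (simp add: field_simps power2_eq_square)
  qed
  finally show ?thesis .
qed

text \<open>Rotating v in the normal plane, which contains \<gamma>'', moves v \<bullet> \<gamma>''
  through all of [- \<kappa>, \<kappa>]. The case x = 0 also provides a point of the bundle over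
  every s.\<close>

lemma exists_unit_normal:
  assumes reg: "regular_tubular_surface a b \<gamma> r" and s: "s \<in> einterval a b"
    and x: "\<bar>x\<bar> \<le> curvature \<gamma> s"
  obtains v where "(s, v) \<in> tube_domain a b \<gamma>" "v \<bullet> curve_deriv (curve_deriv \<gamma>) s = x"
proof -
  let ?T = "curve_deriv \<gamma> s" and ?k = "curve_deriv (curve_deriv \<gamma>) s"
  have T: "norm ?T = 1" using reg s by (simp add: regular_tubular_surface_def)
  have Tk: "?k \<bullet> ?T = 0"
    using tangent_orthogonal_acceleration [OF reg s] by (simp add: inner_commute)
  \<comment> \<open>Where \<gamma>'' vanishes any unit normal can serve as \<open>u\<close>, so that
    the same construction of v covers this case.\<close>
  obtain u where u: "norm u = 1" "u \<bullet> ?T = 0" "?k = norm ?k *\<^sub>R u"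
  proof (cases "?k = 0")
    case True
    obtain u where "u \<noteq> 0" "orthogonal ?T u"
      using orthogonal_to_vector_exists [of ?T] by auto
    then show thesis
      using that [of "u /\<^sub>R norm u"] True by (simp add: orthogonal_def inner_commute)
  next
    case False
    then have "norm (sgn ?k) = 1" "?k = norm ?k *\<^sub>R sgn ?k"
      by (simp_all add: norm_sgn sgn_div_norm)
    moreover have "sgn ?k \<bullet> ?T = 0"
      using Tk by (simp add: sgn_div_norm)
    ultimately show thesis
      using that by blast
  qed
  define B where "B = cross3 u ?T"
  have uu: "u \<bullet> u = 1" using u(1) by (simp add: norm_eq_1)
  have B: "B \<bullet> B = 1" "B \<bullet> ?T = 0" "B \<bullet> u = 0"
    using u(1,2) T by (simp_all add: B_def cross3_of_orthonormal)
  have k: "u \<bullet> ?k = norm ?k" "B \<bullet> ?k = 0"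
    by (subst u(3), simp add: uu B)+
  \<comment> \<open>The cosine of the angle from \<open>u\<close> to the desired v. If \<gamma>'' =
    0, then x = 0 and division by zero gives z = 0, which is still correct.\<close>
  define z where "z = x / norm ?k"
  have z: "\<bar>z\<bar> \<le> 1" "z * norm ?k = x"
    using x by (auto simp: z_def curvature_def divide_le_eq_1)
  define v where "v = z *\<^sub>R u + sqrt (1 - z\<^sup>2) *\<^sub>R B"
  have "v \<bullet> v = z * z + sqrt (1 - z\<^sup>2) * sqrt (1 - z\<^sup>2)"
    unfolding v_def using uu B by (simp add: inner_add_left inner_add_right inner_commute)
  also have "\<dots> = 1"
    using z(1) by (simp add: abs_square_le_1 power2_eq_square [symmetric])
  finally have "norm v = 1" by (simp add: norm_eq_1)
  moreover have "v \<bullet> ?T = 0" "v \<bullet> ?k = x"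
    using u(1,2) B k z by (simp_all add: v_def inner_add_left)
  ultimately show thesis
    using that [of v] s by (simp add: tube_domain_def)
qed

section \<open>Polynomial relations between the curvatures\<close>

lemma poly_poly_pCons_subst: "poly (poly Q p) x = poly (poly Q [:poly p x:]) x"
  by (induction Q) simp_all

text \<open>A single circle over a point with \<kappa> \<noteq> 0 suffices: there c runs through
  [0, \<kappa>], and K is an injective function of c.\<close>

lemma infinite_range_tube_K:
  assumes reg: "regular_tubular_surface a b \<gamma> r" and "\<not> right_cylinder a b \<gamma> r"
  shows "infinite (tube_K a b \<gamma> r ` tube_domain a b \<gamma>)"
proof
  assume fin: "finite (tube_K a b \<gamma> r ` tube_domain a b \<gamma>)"
  obtain s where s: "s \<in> einterval a b" "curvature \<gamma> s \<noteq> 0"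
    using assms by (auto simp: right_cylinder_def)
  then have "0 < curvature \<gamma> s" by (simp add: curvature_def)
  have r: "r > 0" using reg by (simp add: regular_tubular_surface_def)
  let ?f = "\<lambda>x. - x / (r * (1 - r * x))"
  have *: "1 - r * x \<noteq> 0 \<and> ?f x \<in> tube_K a b \<gamma> r ` tube_domain a b \<gamma>"
    if "x \<in> {0..curvature \<gamma> s}" for x
  proof -
    obtain v where v: "(s, v) \<in> tube_domain a b \<gamma>" "v \<bullet> curve_deriv (curve_deriv \<gamma>) s = x"
      using exists_unit_normal [OF reg s(1), of x] \<open>x \<in> _\<close> by auto
    show ?thesis
      using one_minus_normal_acceleration_nonzero [OF reg v(1)] tube_K_eq [OF reg v(1)] v
      by (metis image_eqI)
  qed
  \<comment> \<open>Cross-multiplying, x (1 - r y) = y (1 - r x) reduces to x = y.\<close>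
  have "inj_on ?f {0..curvature \<gamma> s}"
    using * r by (auto intro!: inj_onI simp: field_simps)
  moreover have "finite (?f ` {0..curvature \<gamma> s})"
    by (rule finite_subset [OF _ fin]) (use * in blast)
  ultimately have "finite {0..curvature \<gamma> s}"
    using finite_image_iff by blast
  with \<open>0 < curvature \<gamma> s\<close> show False by (simp add: infinite_Icc)
qed

theorem theorem3:
  fixes a b :: ereal and \<gamma> :: "real \<Rightarrow> real^3" and r :: real
  assumes "regular_tubular_surface a b \<gamma> r"
  shows "(right_cylinder a b \<gamma> r \<longrightarrow> Q_E a b \<gamma> r = {Q. r \<in> Rad_E Q}) \<and>
         (\<not> right_cylinder a b \<gamma> r \<longrightarrow>
            Q_E a b \<gamma> r =
              ideal_generated {poly_x * poly_const (r\<^sup>2) - poly_const (2 * r) * poly_y + 1})"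
proof (intro conjI impI)
  have r: "r > 0" "a < b" using assms by (simp_all add: regular_tubular_surface_def)
  note H = tube_H_eq [OF assms]
  {
    assume cyl: "right_cylinder a b \<gamma> r"
    have K: "tube_K a b \<gamma> r p = 0" if "p \<in> tube_domain a b \<gamma>" for p
    proof -
      obtain s v where p: "p = (s, v)" by (cases p)
      then have "curve_deriv (curve_deriv \<gamma>) s = 0"
        using cyl that by (auto simp: right_cylinder_def curvature_def tube_domain_def)
      then show ?thesis using tube_K_eq [OF assms] that p by simp
    qed
    \<comment> \<open>The bundle must be seen to be nonempty: only then does Q(K, H) = 0 give the
      equation Q(0, 1 / (2 r)) = 0.\<close>
    obtain s where "s \<in> einterval a b"
      using r(2) by (metis einterval_iff ereal_dense2)
    then obtain v where "(s, v) \<in> tube_domain a b \<gamma>"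
      by (rule exists_unit_normal [OF assms _, of s 0]) (simp_all add: curvature_def)
    then show "Q_E a b \<gamma> r = {Q. r \<in> Rad_E Q}"
      using K H r by (force simp: Q_E_def Rad_E_def)
  }
  assume ncyl: "\<not> right_cylinder a b \<gamma> r"
  \<comment> \<open>This is the relation H = q(K) solved for H. The generator equals - 2 r (y -
    q(x)), and \<open>[:- q, 1:]\<close> is the monic factor y - q(x) in \<real>[x][y].\<close>
  define q :: "real poly" where "q = [:1 / (2 * r), r / 2:]"
  let ?g = "poly_x * poly_const (r\<^sup>2) - poly_const (2 * r) * poly_y + 1"
  have g: "?g = poly_const (- (2 * r)) * [:- q, 1:]"
    using r by (simp add: poly_x_def poly_const_def poly_y_def q_def power2_eq_square one_pCons)
  have Hq: "tube_H a b \<gamma> r p = poly q (tube_K a b \<gamma> r p)" if "p \<in> tube_domain a b \<gamma>" for p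
    using H that r by (cases p) (simp add: q_def field_simps power2_eq_square)
  have "Q \<in> Q_E a b \<gamma> r \<longleftrightarrow> ?g dvd Q" for Q
  proof -
    have "Q \<in> Q_E a b \<gamma> r \<longleftrightarrow> (\<forall>x\<in>tube_K a b \<gamma> r ` tube_domain a b \<gamma>. poly (poly Q q) x = 0)"
      by (simp add: Q_E_def eval_xy_def Hq poly_poly_pCons_subst [symmetric])
    \<comment> \<open>Substituting q for y leaves a polynomial in x alone, and a nonzero one has
      only finitely many roots.\<close>
    also have "\<dots> \<longleftrightarrow> poly Q q = 0"
      using infinite_range_tube_K [OF assms ncyl] poly_roots_finite [of "poly Q q"]
      by (metis (mono_tags, lifting) finite_subset mem_Collect_eq poly_0 subsetI)
    also have "\<dots> \<longleftrightarrow> [:- q, 1:] dvd Q"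
      by (rule poly_eq_0_iff_dvd)
    \<comment> \<open>The constant - 2 r is a unit, so the generator and its monic factor have the
      same multiples.\<close>
    also have "\<dots> \<longleftrightarrow> ?g dvd Q"
    proof -
      have "poly_const (- (2 * r)) dvd 1"
        using r by (intro dvdI [of _ _ "poly_const (- 1 / (2 * r))"]) (simp add: poly_const_def one_pCons)
      then show ?thesis unfolding g by (simp only: mult_unit_dvd_iff')
    qed
    finally show ?thesis .
  qed
  then show "Q_E a b \<gamma> r = ideal_generated {?g}"
    by (auto simp: ideal_generated_def module.span_singleton [OF module_times] dvd_def mult.commute)
qed

end
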